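(* Let $A, B$ be finite sets, and let \[\mathrm{Subdirect}(A,B) := \{X \subseteq A\times B : \langle X\rangle \leq_{\mathrm{sd}} A^{+}\times B^{+}\}.\] Then \[|\mathrm{Subdirect}(A,B)| = \sum_{i=0}^{|A|}(-1)^{i}\binom{|A|}{i}\left(2^{|A|-i}-1\right)^{|B|}.\] Moreover, \[\lim_{|A|\to\infty}\frac{|\mathrm{Subdirect}(A,A)|}{|\mathcal{P}(A\times A)|} = 1.\]
   Context: $A^{+}$ is the free semigroup on $A$ (non-empty words under concatenation); elements of $A\times B$ are regarded as pairs of one-letter words in $A^{+}\times B^{+}$, and $\langle X\rangle$ is the subsemigroup of $A^{+}\times B^{+}$ generated by $X$. For a subsemigroup $U$ of $S\times T$, $U \leq_{\mathrm{sd}} S\times T$ ($U$ is a subdirect product) means that both coordinate projections $U\to S$ and $U\to T$ are surjective. $\mathcal{P}$ denotes the power set. In the limit $A$ ranges over finite sets with $|A|\to\infty$. *)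

theory Defs
  imports Complex_Main
begin

text \<open>Semigroups are given by a carrier set and a multiplication on the ambient type.
  As usual for subsemigroups, the empty set is allowed.\<close>

definition subsemigroup :: "('c \<Rightarrow> 'c \<Rightarrow> 'c) \<Rightarrow> 'c set \<Rightarrow> 'c set \<Rightarrow> bool" where
  "subsemigroup m U S \<longleftrightarrow> U \<subseteq> S \<and> (\<forall>x\<in>U. \<forall>y\<in>U. m x y \<in> U)"

inductive_set generated_subsemigroup :: "('c \<Rightarrow> 'c \<Rightarrow> 'c) \<Rightarrow> 'c set \<Rightarrow> 'c set"
  for m :: "'c \<Rightarrow> 'c \<Rightarrow> 'c" and X :: "'c set" where
  gen: "x \<in> X \<Longrightarrow> x \<in> generated_subsemigroup m X"
| mult: "x \<in> generated_subsemigroup m X \<Longrightarrow> y \<in> generated_subsemigroup m X \<Longrightarrow>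
    m x y \<in> generated_subsemigroup m X"

definition direct_mult ::
    "('s \<Rightarrow> 's \<Rightarrow> 's) \<Rightarrow> ('t \<Rightarrow> 't \<Rightarrow> 't) \<Rightarrow> 's \<times> 't \<Rightarrow> 's \<times> 't \<Rightarrow> 's \<times> 't" where
  "direct_mult m n p q = (m (fst p) (fst q), n (snd p) (snd q))"

definition subdirect_product ::
    "('s \<Rightarrow> 's \<Rightarrow> 's) \<Rightarrow> ('t \<Rightarrow> 't \<Rightarrow> 't) \<Rightarrow> ('s \<times> 't) set \<Rightarrow> 's set \<Rightarrow> 't set \<Rightarrow> bool" where
  "subdirect_product m n U S T \<longleftrightarrow>
     subsemigroup (direct_mult m n) U (S \<times> T) \<and> fst ` U = S \<and> snd ` U = T"

definition free_semigroup :: "'a set \<Rightarrow> 'a list set" where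
  "free_semigroup A = {w \<in> lists A. w \<noteq> []}"

definition letter_pair :: "'a \<times> 'b \<Rightarrow> 'a list \<times> 'b list" where
  "letter_pair p = ([fst p], [snd p])"

definition Subdirect :: "'a set \<Rightarrow> 'b set \<Rightarrow> ('a \<times> 'b) set set" where
  "Subdirect A B = {X. X \<subseteq> A \<times> B \<and>
     subdirect_product (@) (@)
       (generated_subsemigroup (direct_mult (@) (@)) (letter_pair ` X))
       (free_semigroup A) (free_semigroup B)}"

text \<open>The filter of finite sets whose cardinality tends to infinity, with no inclusion
  required between the sets. It is trivial when the ambient type is finite, so the content
  of a limit along it lies in its instances at infinite types.\<close>

definition finite_card_at_top :: "'a set filter" where
  "finite_card_at_top = inf (filtercomap card at_top) (principal {A. finite A})"

lemma eventually_finite_card_at_top: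
  "eventually P finite_card_at_top \<longleftrightarrow> (\<exists>N. \<forall>A. finite A \<and> card A \<ge> N \<longrightarrow> P A)"
  unfolding finite_card_at_top_def eventually_inf_principal
    eventually_filtercomap_at_top_linorder by auto

end

theory Submission
  imports Defs "HOL-Library.FuncSet"
begin

text \<open>Membership in \<open>Subdirect A B\<close> is a condition on letters only. Projections are homomorphisms, so the first
  projection of the subsemigroup generated by \<open>X\<close> is generated by the first projection of \<open>X\<close>,
  and hence is the free semigroup on the first projection of \<open>X\<close>; likewise for the second. Since
  a free semigroup determines its alphabet (the one-letter words), \<open>X\<close> lies in
  \<open>Subdirect A B\<close> exactly when \<open>X\<close> is a relation with domain \<open>A\<close> and range \<open>B\<close>
  (\<open>Subdirect_eq_full_relations\<close>).

  For the count, drop the condition on the domain: a relation in \<open>T \<times> B\<close> with range \<open>B\<close> assigns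
  to every point of \<open>B\<close> a nonempty subset of \<open>T\<close>, so there are \<open>(2 ^ |T| - 1) ^ |B|\<close> of them
  (\<open>card_relations_with_full_range\<close>). Sorting these by their actual domain and
  applying Moebius inversion over the subsets of \<open>A\<close> gives the formula.

  For the limit, a relation on an \<open>n\<close>-element set that is not full misses one of \<open>n\<close> rows or one of
  \<open>n\<close> columns, and a prescribed line is empty in a fraction \<open>1 / 2 ^ n\<close> of all relations. So at most a
  fraction \<open>2 * n / 2 ^ n\<close> of the relations fails to be full, and this tends to \<open>0\<close>.\<close>

section \<open>Subdirect products generated by pairs of letters\<close>

lemma image_generated_subsemigroup:
  assumes hom: "\<And>x y. h (m x y) = n (h x) (h y)"
  shows "h ` generated_subsemigroup m X = generated_subsemigroup n (h ` X)"
proof (intro equalityI subsetI)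
  fix y assume "y \<in> h ` generated_subsemigroup m X"
  then obtain x where "x \<in> generated_subsemigroup m X" "y = h x" by blast
  from this(1) have "h x \<in> generated_subsemigroup n (h ` X)"
    by (induction rule: generated_subsemigroup.induct)
      (auto simp: hom intro: generated_subsemigroup.intros)
  then show "y \<in> generated_subsemigroup n (h ` X)" using \<open>y = h x\<close> by simp
next
  fix y assume "y \<in> generated_subsemigroup n (h ` X)"
  then show "y \<in> h ` generated_subsemigroup m X"
  proof (induction rule: generated_subsemigroup.induct)
    case (gen y)
    then show ?case by (auto intro: generated_subsemigroup.gen)
  next
    case (mult y z)
    then obtain u v where "u \<in> generated_subsemigroup m X" "y = h u"
      and "v \<in> generated_subsemigroup m X" "z = h v" by blast
    then show ?case
      by (intro image_eqI[where x = "m u v"]) (auto simp: hom intro: generated_subsemigroup.mult)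
  qed
qed

lemma generated_by_letters_eq_free_semigroup:
  "generated_subsemigroup (@) ((\<lambda>a. [a]) ` C) = free_semigroup C"
proof (intro equalityI subsetI)
  fix w assume "w \<in> generated_subsemigroup (@) ((\<lambda>a. [a]) ` C)"
  then show "w \<in> free_semigroup C"
    by (induction rule: generated_subsemigroup.induct) (auto simp: free_semigroup_def)
next
  fix w assume "w \<in> free_semigroup C"
  then have "w \<noteq> []" "set w \<subseteq> C" by (auto simp: free_semigroup_def)
  then show "w \<in> generated_subsemigroup (@) ((\<lambda>a. [a]) ` C)"
  proof (induction w rule: list_nonempty_induct)
    case (single a)
    then show ?case by (auto intro: generated_subsemigroup.gen)
  next
    case (cons a w)
    then have "[a] \<in> generated_subsemigroup (@) ((\<lambda>a. [a]) ` C)"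
      and "w \<in> generated_subsemigroup (@) ((\<lambda>a. [a]) ` C)"
      by (auto intro: generated_subsemigroup.gen)
    then have "[a] @ w \<in> generated_subsemigroup (@) ((\<lambda>a. [a]) ` C)"
      by (rule generated_subsemigroup.mult)
    then show ?case by simp
  qed
qed

lemma free_semigroup_eq_iff:
  fixes C D :: "'a set"
  shows "free_semigroup C = free_semigroup D \<longleftrightarrow> C = D"
proof
  assume eq: "free_semigroup C = free_semigroup D"
  have letter: "[a] \<in> free_semigroup E \<longleftrightarrow> a \<in> E" for a :: 'a and E
    by (simp add: free_semigroup_def)
  show "C = D" using letter[of _ C] letter[of _ D] eq by auto
qed simp

lemma fst_image_generated_by_letter_pairs:
  "fst ` generated_subsemigroup (direct_mult (@) (@)) (letter_pair ` X) = free_semigroup (fst ` X)"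
proof -
  have "fst ` letter_pair ` X = (\<lambda>a. [a]) ` fst ` X"
    by (auto simp: letter_pair_def image_image)
  then show ?thesis
    by (simp add: image_generated_subsemigroup[where n = "(@)"] direct_mult_def
        generated_by_letters_eq_free_semigroup)
qed

lemma snd_image_generated_by_letter_pairs:
  "snd ` generated_subsemigroup (direct_mult (@) (@)) (letter_pair ` X) = free_semigroup (snd ` X)"
proof -
  have "snd ` letter_pair ` X = (\<lambda>b. [b]) ` snd ` X"
    by (auto simp: letter_pair_def image_image)
  then show ?thesis
    by (simp add: image_generated_subsemigroup[where n = "(@)"] direct_mult_def
        generated_by_letters_eq_free_semigroup)
qed

text \<open>A generated subsemigroup is closed and lies in the product of its own projections, so of
  the definition of a subdirect product only the two projection conditions remain, and these can
  be read off from the letters.\<close>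

theorem Subdirect_eq_full_relations:
  "Subdirect A B = {X. X \<subseteq> A \<times> B \<and> fst ` X = A \<and> snd ` X = B}"
proof -
  have "subdirect_product (@) (@)
       (generated_subsemigroup (direct_mult (@) (@)) (letter_pair ` X))
       (free_semigroup A) (free_semigroup B) \<longleftrightarrow> fst ` X = A \<and> snd ` X = B" for X
  proof -
    let ?U = "generated_subsemigroup (direct_mult (@) (@)) (letter_pair ` X)"
    have "?U \<subseteq> fst ` ?U \<times> snd ` ?U" by force
    then have "subsemigroup (direct_mult (@) (@)) ?U (fst ` ?U \<times> snd ` ?U)"
      by (auto simp: subsemigroup_def intro: generated_subsemigroup.mult)
    then show ?thesis
      unfolding subdirect_product_def
      by (metis fst_image_generated_by_letter_pairs snd_image_generated_by_letter_pairs
          free_semigroup_eq_iff)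
  qed
  then show ?thesis by (simp add: Subdirect_def)
qed

section \<open>Counting relations with full domain and range\<close>

text \<open>Such a relation is the same thing as a choice, for each element of \<open>B\<close>, of a nonempty
  fibre in \<open>T\<close>.\<close>

lemma card_relations_with_full_range:
  assumes "finite T" "finite B"
  shows "card {X. X \<subseteq> T \<times> B \<and> snd ` X = B} = (2 ^ card T - 1) ^ card B"
proof -
  let ?R = "{X. X \<subseteq> T \<times> B \<and> snd ` X = B}"
  let ?F = "B \<rightarrow>\<^sub>E (Pow T - {{}})"
  have "bij_betw (\<lambda>X. \<lambda>b\<in>B. {a. (a, b) \<in> X}) ?R ?F"
  proof (rule bij_betw_byWitness[where f' = "\<lambda>F. {(a, b). b \<in> B \<and> a \<in> F b}"])
    show "\<forall>X\<in>?R. {(a, b). b \<in> B \<and> a \<in> (\<lambda>b\<in>B. {a. (a, b) \<in> X}) b} = X" by auto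
    show "\<forall>F\<in>?F. (\<lambda>b\<in>B. {a. (a, b) \<in> {(a, b). b \<in> B \<and> a \<in> F b}}) = F"
      by (auto simp: restrict_def PiE_def extensional_def fun_eq_iff)
    show "(\<lambda>X. \<lambda>b\<in>B. {a. (a, b) \<in> X}) ` ?R \<subseteq> ?F" by force
    show "(\<lambda>F. {(a, b). b \<in> B \<and> a \<in> F b}) ` ?F \<subseteq> ?R"
    proof clarify
      fix F assume F: "F \<in> ?F"
      then have "\<exists>a. a \<in> F b" if "b \<in> B" for b using that by fastforce
      then have "snd ` {(a, b). b \<in> B \<and> a \<in> F b} = B" by force
      moreover have "{(a, b). b \<in> B \<and> a \<in> F b} \<subseteq> T \<times> B" using F by fastforce
      ultimately show "{(a, b). b \<in> B \<and> a \<in> F b} \<subseteq> T \<times> B \<and>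
          snd ` {(a, b). b \<in> B \<and> a \<in> F b} = B" by blast
    qed
  qed
  then have "card ?R = card ?F" by (rule bij_betw_same_card)
  also have "\<dots> = (2 ^ card T - 1) ^ card B"
    using assms by (simp add: card_funcsetE card_Diff_subset card_Pow)
  finally show ?thesis .
qed

lemma sum_Pow_card:
  fixes h :: "nat \<Rightarrow> int"
  assumes "finite A"
  shows "(\<Sum>T\<in>Pow A. h (card T)) = (\<Sum>k=0..card A. int (card A choose k) * h k)"
proof -
  have "(\<Sum>T\<in>Pow A. h (card T)) = (\<Sum>k=0..card A. \<Sum>T | T \<in> Pow A \<and> card T = k. h (card T))"
    using assms by (intro sum.group[symmetric]) (auto intro: card_mono)
  also have "\<dots> = (\<Sum>k=0..card A. int (card A choose k) * h k)"
    using n_subsets[OF assms] by (intro sum.cong) (auto simp: Pow_def)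
  finally show ?thesis .
qed

theorem card_Subdirect:
  assumes "finite A" "finite B"
  shows "int (card (Subdirect A B)) =
      (\<Sum>i=0..card A. (-1) ^ i * int (card A choose i) * (2 ^ (card A - i) - 1) ^ card B)"
proof -
  let ?n = "card A"
  define f where "f D = int (card (Subdirect D B))" for D :: "'a set"
  define g where "g T = int (card {X. X \<subseteq> T \<times> B \<and> snd ` X = B})" for T :: "'a set"
  have g: "g T = (2 ^ card T - 1) ^ card B" if "finite T" for T
    unfolding g_def card_relations_with_full_range[OF that assms(2)] by simp
  \<comment> \<open>Sorting relations by their domain expresses \<open>g\<close> as the sum of \<open>f\<close> over subsets.\<close>
  have "g T = sum f (Pow T)" if "finite T" for T
  proof -
    have "{X. X \<subseteq> T \<times> B \<and> snd ` X = B} = (\<Union>D\<in>Pow T. Subdirect D B)"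
    proof (intro equalityI subsetI)
      fix X assume "X \<in> {X. X \<subseteq> T \<times> B \<and> snd ` X = B}"
      then have "fst ` X \<in> Pow T" "X \<in> Subdirect (fst ` X) B"
        by (force simp: Subdirect_eq_full_relations)+
      then show "X \<in> (\<Union>D\<in>Pow T. Subdirect D B)" by (rule UN_I)
    next
      fix X assume "X \<in> (\<Union>D\<in>Pow T. Subdirect D B)"
      then obtain D where "D \<subseteq> T" "X \<subseteq> D \<times> B" "snd ` X = B"
        by (auto simp: Subdirect_eq_full_relations)
      then show "X \<in> {X. X \<subseteq> T \<times> B \<and> snd ` X = B}" by blast
    qed
    moreover have "finite (Subdirect D B)" if "D \<in> Pow T" for D
    proof (rule finite_subset)
      show "Subdirect D B \<subseteq> Pow (D \<times> B)" unfolding Subdirect_def by blast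
      show "finite (Pow (D \<times> B))" using that \<open>finite T\<close> assms(2) by (auto intro: finite_subset)
    qed
    moreover have "Subdirect D B \<inter> Subdirect E B = {}" if "D \<noteq> E"
      for D E :: "'a set"
      using that unfolding Subdirect_eq_full_relations by blast
    ultimately have "card {X. X \<subseteq> T \<times> B \<and> snd ` X = B} = (\<Sum>D\<in>Pow T. card (Subdirect D B))"
      using \<open>finite T\<close> by (simp add: card_UN_disjoint)
    then show ?thesis by (simp add: f_def g_def)
  qed
  then have "f A = (\<Sum>T\<in>Pow A. (-1) ^ (?n - card T) * g T)"
    using assms(1) by (rule inclusion_exclusion_mobius)
  also have "\<dots> = (\<Sum>T\<in>Pow A. (-1) ^ (?n - card T) * (2 ^ card T - 1) ^ card B)"
    using assms(1) by (intro sum.cong) (auto simp: g finite_subset)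
  also have "\<dots> = (\<Sum>k=0..?n. int (?n choose k) * ((-1) ^ (?n - k) * (2 ^ k - 1) ^ card B))"
    using assms(1) by (rule sum_Pow_card)
  also have "\<dots> = (\<Sum>i=0..?n. (-1) ^ i * int (?n choose i) * (2 ^ (?n - i) - 1) ^ card B)"
    by (rule sum.reindex_bij_witness[where i = "\<lambda>i. ?n - i" and j = "\<lambda>k. ?n - k"])
      (auto simp: binomial_symmetric[symmetric])
  finally show ?thesis by (simp add: f_def)
qed

section \<open>Almost all relations have full domain and range\<close>

text \<open>The lower bound is the union bound over the \<open>n\<close> rows and \<open>n\<close> columns that a relation may miss:
  a relation missing a given line lives on the \<open>n * (n - 1)\<close> pairs off that line.\<close>

lemma Subdirect_ratio_bounds:
  assumes "finite C"
  defines "r \<equiv> real (card (Subdirect C C)) / real (card (Pow (C \<times> C)))"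
  shows "1 - 2 * (real (card C) / 2 ^ card C) \<le> r" and "r \<le> 1"
proof -
  let ?n = "card C"
  let ?P = "Pow (C \<times> C)"
  let ?row = "\<lambda>a. Pow ((C - {a}) \<times> C)"
  let ?col = "\<lambda>b. Pow (C \<times> (C - {b}))"
  have cardP: "card ?P = 2 ^ (?n * ?n)"
    using assms(1) by (simp add: card_Pow card_cartesian_product)
  have sub: "Subdirect C C \<subseteq> ?P" unfolding Subdirect_def by blast
  have fin: "finite ?P" using assms(1) by simp
  show "r \<le> 1"
    unfolding r_def using card_mono[OF fin sub] by (simp add: divide_le_eq)
  have line: "card (?row a) = 2 ^ (?n * (?n - 1))" "card (?col a) = 2 ^ (?n * (?n - 1))"
    if "a \<in> C" for a
    using that assms(1) by (simp_all add: card_Pow card_cartesian_product mult.commute)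
  have "?P \<subseteq> Subdirect C C \<union> ((\<Union>a\<in>C. ?row a) \<union> (\<Union>b\<in>C. ?col b))"
  proof
    fix X assume X: "X \<in> ?P"
    show "X \<in> Subdirect C C \<union> ((\<Union>a\<in>C. ?row a) \<union> (\<Union>b\<in>C. ?col b))"
    proof (cases "fst ` X = C \<and> snd ` X = C")
      case True
      with X show ?thesis unfolding Subdirect_eq_full_relations by blast
    next
      case False
      with X obtain c where "c \<in> C" "c \<notin> fst ` X \<or> c \<notin> snd ` X" by auto
      with X have "X \<in> ?row c \<or> X \<in> ?col c" by force
      with \<open>c \<in> C\<close> show ?thesis by blast
    qed
  qed
  then have "card ?P \<le> card (Subdirect C C \<union> ((\<Union>a\<in>C. ?row a) \<union> (\<Union>b\<in>C. ?col b)))"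
    using assms(1) finite_subset[OF sub fin] by (intro card_mono) auto
  also have "\<dots> \<le> card (Subdirect C C) + (card (\<Union>a\<in>C. ?row a) + card (\<Union>b\<in>C. ?col b))"
    by (meson add_left_mono card_Un_le order_trans)
  also have "\<dots> \<le> card (Subdirect C C) + ((\<Sum>a\<in>C. card (?row a)) + (\<Sum>b\<in>C. card (?col b)))"
    using assms(1) by (intro add_mono card_UN_le) auto
  also have "\<dots> = card (Subdirect C C) + 2 * ?n * 2 ^ (?n * (?n - 1))"
    by (simp add: line)
  finally have "real (2 ^ (?n * ?n)) \<le> real (card (Subdirect C C) + 2 * ?n * 2 ^ (?n * (?n - 1)))"
    unfolding cardP of_nat_le_iff .
  then have *: "2 ^ (?n * ?n) - 2 * real ?n * 2 ^ (?n * (?n - 1)) \<le> real (card (Subdirect C C))"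
    by simp
  \<comment> \<open>For \<open>n = 0\<close> the truncated \<open>n - 1\<close> does no harm, as it is multiplied by \<open>n\<close>.\<close>
  have "(2::real) ^ (?n * ?n) = 2 ^ (?n * (?n - 1)) * 2 ^ ?n"
    by (cases ?n) (simp_all flip: power_add add: algebra_simps)
  then have "1 - 2 * (real ?n / 2 ^ ?n)
      = (2 ^ (?n * ?n) - 2 * real ?n * 2 ^ (?n * (?n - 1))) / 2 ^ (?n * ?n)"
    by (simp add: field_simps)
  also have "\<dots> \<le> r"
    unfolding r_def cardP using divide_right_mono[OF *, of "2 ^ (?n * ?n)"] by simp
  finally show "1 - 2 * (real ?n / 2 ^ ?n) \<le> r" .
qed

lemma filterlim_card_finite_card_at_top: "filterlim card at_top finite_card_at_top"
  unfolding finite_card_at_top_def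
  by (rule filterlim_mono[OF filterlim_filtercomap order_refl inf_le1])

theorem Subdirect_ratio_tendsto_1:
  "((\<lambda>C. real (card (Subdirect C C)) / real (card (Pow (C \<times> C)))) \<longlongrightarrow> 1) finite_card_at_top"
proof -
  have "(\<lambda>n. real n / 2 ^ n) \<longlonglongrightarrow> 0"
    using lim_n_over_pown[of "2::real"] by simp
  then have "(\<lambda>n. 1 - 2 * (real n / 2 ^ n)) \<longlonglongrightarrow> 1 - 2 * 0"
    by (intro tendsto_intros)
  then have lower: "((\<lambda>C. 1 - 2 * (real (card C) / 2 ^ card C)) \<longlongrightarrow> 1) finite_card_at_top"
    using filterlim_compose[OF _ filterlim_card_finite_card_at_top] by simp
  show ?thesis
    by (rule tendsto_sandwich[OF _ _ lower tendsto_const])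
      (auto simp only: eventually_finite_card_at_top intro: Subdirect_ratio_bounds)
qed

section \<open>The number and the proportion of subdirect products\<close>

theorem proposition6p1:
  fixes A :: "'a set" and B :: "'b set"
  assumes "finite A" and "finite B"
  shows "int (card (Subdirect A B)) =
      (\<Sum>i=0..card A. (-1) ^ i * int (card A choose i) * (2 ^ (card A - i) - 1) ^ card B)
    \<and> ((\<lambda>C :: 'c set. real (card (Subdirect C C)) / real (card (Pow (C \<times> C)))) \<longlongrightarrow> 1)
      finite_card_at_top"
  using card_Subdirect[OF assms] Subdirect_ratio_tendsto_1 by blast

end
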